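(* Let $\mathbb{F}$ be a field of characteristic $0$, let $a,b,c\in\mathbb{F}$, and consider the (nonzero) operator identity $$R = a\,L(xy) + b\,L(x)y + c\,xL(y)\in\mathcal{O}(2,1).$$ The matrix of consequences $M(R)$ has rank $14$ or $17$. Rank $14$ occurs if and only if the values of the coefficients $(a,b,c)$ (up to nonzero scalar multiples) correspond to one of the following six operator identities: $$L(xy)=0,\qquad L(xy)=xL(y),\qquad L(xy)=L(x)y,$$ $$L(xy)=L(x)y+xL(y),\qquad L(x)y=0,\qquad xL(y)=0.$$
   Context: Operator monomials. An operator monomial is a formal expression built from argument symbols, an associative (non-unital) product written as juxtaposition, and a formal unary operator symbol $L$: a single argument is an operator monomial; if $m$ is one then so is $L(m)$; if $m,m'$ are operator monomials then so is the product $mm'$, and $(mm')m''=m(m'm'')$. The degree is the number of arguments and the multiplicity is the number of occurrences of $L$. The arguments are always $a_1,a_2,\dots,a_p$ in this order from left to right (for $p=2$ written $x,y$), each occurring once. $\mathcal{M}(p,q)$ is the set of all operator monomials of degree $p$ and multiplicity $q$, and $\mathcal{O}(p,q)$ is the vector space over the base field $\mathbb{F}$ (of characteristic $0$) with basis $\mathcal{M}(p,q)$. $L$ is treated as linear and the product as bilinear. An operator identity of degree $p$ and multiplicity $q$ is a nonzero element $R\in\mathcal{O}(p,q)$; it is also written as an equation $R=0$ or $I_1=I_2$ with $R=I_1-I_2$. One has $\mathcal{M}(2,1)=\{L(xy),\,L(x)y,\,xL(y)\}$ and $|\mathcal{M}(3,2)|=20$. Partial compositions. For $m\in\mathcal{M}(p,q)$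 (all operations below are extended linearly to $\mathcal{O}(p,q)$): - $m\circ_i B\in\mathcal{M}(p+1,q)$, $1\le i\le p$: replace the $i$-th argument of $m$ by the product of two arguments, then relabel all arguments $a_1,\dots,a_{p+1}$ from left to right. - $B\circ_1 m\in\mathcal{M}(p+1,q)$ (resp. $B\circ_2 m$): multiply $m$ on the right (resp. on the left) by a new argument, then relabel the arguments from left to right. - $m\circ_i L\in\mathcal{M}(p,q+1)$, $1\le i\le p$: replace the $i$-th argument $a_i$ of $m$ by $L(a_i)$. - $L\circ m\in\mathcal{M}(p,q+1)$: the monomial $L(m)$. Matrix of consequences. For $R\in\mathcal{O}(2,q)$, consider the following $28$ elements of $\mathcal{O}(3,q+1)$: (i) $(R\circ_i B)\circ_k L$, $(B\circ_j R)\circ_k L$, $L\circ(R\circ_i B)$, $L\circ(B\circ_j R)$ with $1\le i\le 2$, $1\le j\le 2$, $1\le k\le 3$ (these are $16$ elements); (ii) $(R\circ_i L)\circ_k B$, $(L\circ R)\circ_k B$, $B\circ_j(R\circ_i L)$, $B\circ_j(L\circ R)$ with $1\le i,k\le 2$, $1\le j\le 2$ (these are $12$ elements). The matrix of consequences $M(R)$ is the matrix whose rows are the coefficient vectors of these elements with respect to the basis $\mathcal{M}(3,q+1)$ (in any fixed order). Eight of the elements in (ii) coincide with elements in (i), so one may delete the $8$ repeated rows without changing the rank; for $q=1$ this gives a $20\times 20$ matrix. *)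

theory Defs
  imports "HOL-Library.Poly_Mapping" "Jordan_Normal_Form.DL_Rank"
begin

text \<open>
  Words over single arguments and words with \<open>L\<close> applied to them. The associative non-unital
  product is concatenation of nonempty words, so associativity holds definitionally.
\<close>

datatype factor = Arg nat | Op "factor list"

type_synonym omon = "factor list"

abbreviation L :: "omon \<Rightarrow> omon" where "L m \<equiv> [Op m]"

inductive_set op_monomials :: "omon set" where
  arg: "[Arg i] \<in> op_monomials"
| op: "m \<in> op_monomials \<Longrightarrow> L m \<in> op_monomials"
| prod: "m \<in> op_monomials \<Longrightarrow> m' \<in> op_monomials \<Longrightarrow> m @ m' \<in> op_monomials"

fun args :: "omon \<Rightarrow> nat list" where
  "args [] = []"
| "args (Arg i # m) = i # args m"
| "args (Op u # m) = args u @ args m"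

fun op_mult :: "omon \<Rightarrow> nat" where
  "op_mult [] = 0"
| "op_mult (Arg i # m) = op_mult m"
| "op_mult (Op u # m) = Suc (op_mult u + op_mult m)"

definition op_degree :: "omon \<Rightarrow> nat" where
  "op_degree m = length (args m)"

definition Mon :: "nat \<Rightarrow> nat \<Rightarrow> omon set" where
  "Mon p q = {m \<in> op_monomials. args m = [1..<Suc p] \<and> op_mult m = q}"

fun subst :: "(nat \<Rightarrow> omon) \<Rightarrow> omon \<Rightarrow> omon" where
  "subst s [] = []"
| "subst s (Arg i # m) = s i @ subst s m"
| "subst s (Op u # m) = Op (subst s u) # subst s m"

text \<open>
  Partial compositions of monomials. They are meant for monomials in some \<open>Mon p q\<close>; the
  relabelling of the arguments from left to right is built into the substitutions.
\<close>

definition comp_B :: "nat \<Rightarrow> omon \<Rightarrow> omon" where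
  "comp_B i = subst (\<lambda>j. if j < i then [Arg j]
                         else if j = i then [Arg i, Arg (Suc i)]
                         else [Arg (Suc j)])"

definition comp_L :: "nat \<Rightarrow> omon \<Rightarrow> omon" where
  "comp_L i = subst (\<lambda>j. if j = i then L [Arg j] else [Arg j])"

text \<open>Only \<open>j = 1\<close> and \<open>j = 2\<close> are meaningful below; every \<open>j \<noteq> 1\<close> is treated like \<open>2\<close>.\<close>

definition B_comp :: "nat \<Rightarrow> omon \<Rightarrow> omon" where
  "B_comp j m = (if j = 1 then m @ [Arg (Suc (op_degree m))]
                 else [Arg 1] @ subst (\<lambda>k. [Arg (Suc k)]) m)"

text \<open>
  The space \<open>O(p,q)\<close> consists of the finitely supported functions with support in \<open>Mon p q\<close>.
\<close>

type_synonym 'a opoly = "omon \<Rightarrow>\<^sub>0 'a"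

abbreviation omon_vec :: "omon \<Rightarrow> 'a::field_char_0 opoly" where
  "omon_vec m \<equiv> Poly_Mapping.single m 1"

definition scale :: "'a::field_char_0 \<Rightarrow> 'a opoly \<Rightarrow> 'a opoly" where
  "scale t R = Poly_Mapping.map (\<lambda>x. t * x) R"

definition lin :: "(omon \<Rightarrow> omon) \<Rightarrow> 'a::field_char_0 opoly \<Rightarrow> 'a opoly" where
  "lin f R = (\<Sum>m\<in>Poly_Mapping.keys R. Poly_Mapping.single (f m) (Poly_Mapping.lookup R m))"

definition consequences :: "'a::field_char_0 opoly \<Rightarrow> 'a opoly list" where
  "consequences R =
     [lin (comp_L k) (lin (comp_B i) R). i \<leftarrow> [1, 2], k \<leftarrow> [1, 2, 3]] @
     [lin (comp_L k) (lin (B_comp j) R). j \<leftarrow> [1, 2], k \<leftarrow> [1, 2, 3]] @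
     [lin L (lin (comp_B i) R). i \<leftarrow> [1, 2]] @
     [lin L (lin (B_comp j) R). j \<leftarrow> [1, 2]] @
     [lin (comp_B k) (lin (comp_L i) R). i \<leftarrow> [1, 2], k \<leftarrow> [1, 2]] @
     [lin (comp_B k) (lin L R). k \<leftarrow> [1, 2]] @
     [lin (B_comp j) (lin (comp_L i) R). i \<leftarrow> [1, 2], j \<leftarrow> [1, 2]] @
     [lin (B_comp j) (lin L R). j \<leftarrow> [1, 2]]"

text \<open>
  The list \<open>bs\<close> is an ordering of the basis \<open>Mon 3 (q + 1)\<close>, where \<open>R\<close> lies in \<open>O(2,q)\<close>.
\<close>

definition consequence_matrix :: "omon list \<Rightarrow> 'a::field_char_0 opoly \<Rightarrow> 'a mat" where
  "consequence_matrix bs R =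
     mat_of_rows_list (length bs)
       [[Poly_Mapping.lookup S m. m \<leftarrow> bs]. S \<leftarrow> consequences R]"

definition mat_rank :: "'a::field mat \<Rightarrow> nat" where
  "mat_rank A = vec_space.rank (dim_row A) A"

abbreviation L_xy :: omon where "L_xy \<equiv> L [Arg 1, Arg 2]"
abbreviation Lx_y :: omon where "Lx_y \<equiv> L [Arg 1] @ [Arg 2]"
abbreviation x_Ly :: omon where "x_Ly \<equiv> [Arg 1] @ L [Arg 2]"

definition rank14_identities :: "'a::field_char_0 opoly set" where
  "rank14_identities =
     {omon_vec L_xy,
      omon_vec L_xy - omon_vec x_Ly,
      omon_vec L_xy - omon_vec Lx_y,
      omon_vec L_xy - (omon_vec Lx_y + omon_vec x_Ly),
      omon_vec Lx_y,
      omon_vec x_Ly}"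

end

theory Submission
  imports Defs
begin

text \<open>
  The rank is \<open>20\<close> minus the dimension of the space of linear functionals on the span of the \<open>20\<close>
  monomials that vanish on all consequences of \<open>R\<close>. A functional annihilates the consequences exactly
  if its values satisfy \<open>20\<close> linear equations, each an instance of \<open>R\<close> (\<open>annihilates_identity_iff\<close>), so
  the task is to count the free parameters of this system.

  If \<open>a \<noteq> 0\<close>, the identity is a rule \<open>L(uv) = \<beta> L(u)v + \<gamma> uL(v)\<close>, by which \<open>L\<close> descends to single
  arguments. Six monomials are then left over, the words in \<open>x, y, z\<close> in this order with two operators
  distributed over them. The rule can be applied to \<open>L(uvw)\<close> by splitting the product in two ways, and
  the results agree if and only if \<open>(\<beta>\<^sup>2 - \<beta>) L(u)vw = (\<gamma>\<^sup>2 - \<gamma>) uvL(w)\<close>. So for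
  \<open>\<beta>, \<gamma> \<in> {0, 1}\<close> all six parameters are free and the rank is \<open>14\<close>; these are the four identities
  of the six that have \<open>a \<noteq> 0\<close>. Otherwise this relation, with the second operator on each of the three
  arguments in turn, gives three independent constraints, which imply all others, and the rank is \<open>17\<close>
  (\<open>annihilates_derivation_iff\<close>, \<open>rank_derivation\<close>).

  If \<open>a = 0\<close> and exactly one of \<open>b, c\<close> vanishes, the consequences kill \<open>14\<close> monomials and leave the other six
  free. If \<open>a = 0\<close> and \<open>b, c \<noteq> 0\<close>, the identity moves \<open>L\<close> between neighbouring factors, and a functional
  is determined by its values at \<open>xyL(L(z))\<close>, \<open>L(xyL(z))\<close> and \<open>L(L(xyz))\<close>, which leaves rank \<open>17\<close>
  (\<open>rank_transfer\<close>).
\<close>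

section \<open>Rank and free coordinates of the null space\<close>

text \<open>
  The dimension of the null space of \<open>A\<close> is read off from a set \<open>I\<close> of free coordinates: a null vector
  is determined by its entries on \<open>I\<close>, and these can be prescribed. The reason is that the columns
  outside \<open>I\<close> form a basis of the column space. A linear relation between them is a null vector that
  vanishes on \<open>I\<close>, hence is trivial; and a null vector whose only nonzero entry on \<open>I\<close> is \<open>-1\<close> at \<open>i\<close>
  expresses column \<open>i\<close> through them.
\<close>

lemma rank_eq_codim_of_relations:
  fixes A :: "'a::field mat"
  assumes A: "A \<in> carrier_mat nr nc"
    and I: "I \<subseteq> {..<nc}"
    and unique: "\<And>c j. (\<And>r. r < nr \<Longrightarrow> (\<Sum>j<nc. A $$ (r, j) * c j) = 0) \<Longrightarrow>
      (\<And>i. i \<in> I \<Longrightarrow> c i = 0) \<Longrightarrow> j < nc \<Longrightarrow> c j = 0"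
    and extend: "\<And>g. \<exists>c. (\<forall>r<nr. (\<Sum>j<nc. A $$ (r, j) * c j) = 0) \<and> (\<forall>i\<in>I. c i = g i)"
  shows "vec_space.rank nr A = nc - card I"
proof -
  interpret vec_space "TYPE('a)" nr .
  define J where "J = {..<nc} - I"
  define U where "U = col A ` J"
  have J: "finite J" "\<And>j. j \<in> J \<Longrightarrow> j < nc" "\<And>j. j \<in> J \<Longrightarrow> j \<notin> I"
    by (auto simp: J_def)
  have sum_J: "(\<Sum>j<nc. h j) = (\<Sum>j\<in>J. h j)" if "\<And>i. i \<in> I \<Longrightarrow> h i = (0::'a)" for h
    by (rule sum.mono_neutral_right) (use that in \<open>auto simp: J_def\<close>)
  have inj: "inj_on (col A) J"
  proof (rule inj_onI, rule ccontr)
    fix j k assume jk: "j \<in> J" "k \<in> J" "col A j = col A k" "j \<noteq> k"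
    define c where "c i = (if i = j then 1 else if i = k then - 1 else (0::'a))" for i
    have "(\<Sum>i<nc. A $$ (r, i) * c i) = 0" if "r < nr" for r
    proof -
      have "(\<Sum>i<nc. A $$ (r, i) * c i) = (\<Sum>i\<in>{j, k}. A $$ (r, i) * c i)"
        by (rule sum.mono_neutral_right) (use jk J in \<open>auto simp: c_def\<close>)
      also have "\<dots> = col A j $ r - col A k $ r"
        using jk(1,2,4) J that A by (simp add: c_def)
      finally show ?thesis using jk by simp
    qed
    then have "c j = 0"
      by (rule unique) (use jk J in \<open>auto simp: c_def\<close>)
    then show False by (simp add: c_def)
  qed
  have U: "U \<subseteq> carrier_vec nr" "finite U" "U \<subseteq> set (cols A)"
    using A J by (auto simp: U_def cols_def)
  have lincomb_U: "lincomb d U $ r = (\<Sum>j\<in>J. A $$ (r, j) * d (col A j))" if "r < nr" for d r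
  proof -
    have "lincomb d U $ r = (\<Sum>x\<in>U. d x * x $ r)"
      using that U by (simp add: lincomb_index)
    also have "\<dots> = (\<Sum>j\<in>J. d (col A j) * col A j $ r)"
      unfolding U_def by (rule sum.reindex[OF inj, unfolded comp_def])
    also have "\<dots> = (\<Sum>j\<in>J. A $$ (r, j) * d (col A j))"
      using that J A by (intro sum.cong) auto
    finally show ?thesis .
  qed
  have indpt: "lin_indpt U"
  proof (rule finite_lin_indpt2[OF \<open>finite U\<close> \<open>U \<subseteq> carrier_vec nr\<close>])
    fix d assume d: "lincomb d U = 0\<^sub>v nr"
    show "\<forall>v\<in>U. d v = 0"
    proof
      fix v assume "v \<in> U"
      then obtain j where j: "j \<in> J" "v = col A j" by (auto simp: U_def)
      define c where "c i = (if i \<in> J then d (col A i) else 0)" for i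
      have "(\<Sum>i<nc. A $$ (r, i) * c i) = 0" if "r < nr" for r
      proof -
        have "(\<Sum>i<nc. A $$ (r, i) * c i) = (\<Sum>i\<in>J. A $$ (r, i) * c i)"
          by (rule sum_J) (use J in \<open>auto simp: c_def\<close>)
        also have "\<dots> = lincomb d U $ r"
          using that by (simp add: lincomb_U c_def)
        finally show ?thesis using d that by simp
      qed
      then have "c j = 0"
        by (rule unique) (use j J in \<open>auto simp: c_def\<close>)
      then show "d v = 0" using j by (simp add: c_def)
    qed
  qed
  have in_span: "col A i \<in> span U" if i: "i < nc" for i
  proof (cases "i \<in> J")
    case True
    then show ?thesis using in_own_span[OF U(1)] by (auto simp: U_def)
  next
    case False
    then have "i \<in> I" using i by (auto simp: J_def)
    obtain c where c: "\<And>r. r < nr \<Longrightarrow> (\<Sum>j<nc. A $$ (r, j) * c j) = 0"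
      and cI: "\<And>k. k \<in> I \<Longrightarrow> c k = (if k = i then - 1 else 0)"
      using extend[of "\<lambda>k. if k = i then - 1 else 0"] by auto
    define d where "d v = c (the_inv_into J (col A) v)" for v
    have "col A i = lincomb d U"
    proof (rule eq_vecI)
      fix r assume "r < dim_vec (lincomb d U)"
      then have r: "r < nr" using U by (simp add: lincomb_dim)
      have "(\<Sum>j<nc. A $$ (r, j) * (if j = i then 0 else c j)) + A $$ (r, i) * c i
          = (\<Sum>j<nc. A $$ (r, j) * c j)"
        using i by (subst (1 2) sum.remove[of _ i]) auto
      also have "\<dots> = 0" using c r by blast
      finally have "A $$ (r, i) = (\<Sum>j<nc. A $$ (r, j) * (if j = i then 0 else c j))"
        using cI[OF \<open>i \<in> I\<close>] by simp
      also have "\<dots> = (\<Sum>j\<in>J. A $$ (r, j) * (if j = i then 0 else c j))"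
        by (rule sum_J) (use cI in auto)
      also have "\<dots> = (\<Sum>j\<in>J. A $$ (r, j) * d (col A j))"
        using False by (intro sum.cong) (auto simp: d_def the_inv_into_f_f[OF inj])
      finally show "col A i $ r = lincomb d U $ r"
        using r i A by (simp add: lincomb_U)
    qed (use U A in \<open>auto simp: lincomb_dim\<close>)
    then show ?thesis using U by (auto simp: span_def intro!: exI[of _ d] exI[of _ U])
  qed
  have "maximal U (\<lambda>T. T \<subseteq> set (cols A) \<and> lin_indpt T)"
    unfolding maximal_def
  proof (intro conjI allI impI)
    fix T assume T: "U \<subseteq> T \<and> T \<subseteq> set (cols A) \<and> lin_indpt T"
    have "T \<subseteq> U"
    proof (rule ccontr)
      assume "\<not> T \<subseteq> U"
      then obtain v where v: "v \<in> T" "v \<notin> U" by auto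
      have "v \<in> span U" using v T in_span A by (auto simp: cols_def)
      moreover have "lin_indpt (insert v U)"
        using T v subset_li_is_li by (metis insert_subset)
      ultimately show False
        using lin_dep_iff_in_span[of U v] U v T indpt cols_dim[of A] A by auto
    qed
    then show "T = U" using T by auto
  qed (use U indpt in auto)
  then have "rank A = card U" using A by (intro rank_card_indpt)
  also have "\<dots> = card J" unfolding U_def by (rule card_image[OF inj])
  also have "\<dots> = nc - card I" unfolding J_def using I by (subst card_Diff_subset) (auto intro: finite_subset)
  finally show ?thesis .
qed

section \<open>The monomials of degree three and multiplicity two\<close>

fun valid :: "omon \<Rightarrow> bool" where
  "valid [] \<longleftrightarrow> True"
| "valid (Arg i # m) \<longleftrightarrow> valid m"
| "valid (Op u # m) \<longleftrightarrow> u \<noteq> [] \<and> valid u \<and> valid m"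

lemma valid_append [simp]: "valid (u @ v) \<longleftrightarrow> valid u \<and> valid v"
  by (induction u rule: valid.induct) auto

lemma args_append [simp]: "args (u @ v) = args u @ args v"
  by (induction u rule: args.induct) auto

text \<open>
  Operator monomials are closed under products, so the inductive definition derives one monomial in
  many ways; the recursive predicate describes each of them once, factor by factor.
\<close>

lemma op_monomials_iff: "m \<in> op_monomials \<longleftrightarrow> m \<noteq> [] \<and> valid m"
proof
  show "m \<in> op_monomials \<Longrightarrow> m \<noteq> [] \<and> valid m"
    by (induction rule: op_monomials.induct) auto
  have "valid m \<Longrightarrow> m \<noteq> [] \<Longrightarrow> m \<in> op_monomials"
  proof (induction m rule: valid.induct)
    case (2 i m)
    then show ?case
      using op_monomials.arg op_monomials.prod[of "[Arg i]" m] by (cases "m = []") auto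
  next
    case (3 u m)
    then show ?case
      using op_monomials.op[of u] op_monomials.prod[of "L u" m] by (cases "m = []") auto
  qed auto
  then show "m \<noteq> [] \<and> valid m \<Longrightarrow> m \<in> op_monomials" by blast
qed

lemma args_eq_Nil_iff: "valid m \<Longrightarrow> args m = [] \<longleftrightarrow> m = []"
  by (induction m rule: valid.induct) auto

text \<open>
  All words with given argument sequence and multiplicity, found by splitting off the first factor:
  it is either the first argument, or \<open>L\<close> applied to a word on the first \<open>k\<close> arguments. The empty
  word is included because it occurs as the remainder. Pairs are drawn from a product list so that
  the induction rule gives the hypotheses for \<open>u\<close> and \<open>w\<close> independently.
\<close>

function words :: "nat list \<Rightarrow> nat \<Rightarrow> omon list" where
  "words [] 0 = [[]]"
| "words [] (Suc q) = []"
| "words (x # xs) q =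
     map ((#) (Arg x)) (words xs q) @
     [Op u # w. k \<leftarrow> [1..<Suc (length (x # xs))], i \<leftarrow> [0..<q],
        (u, w) \<leftarrow> List.product (words (take k (x # xs)) i) (words (drop k (x # xs)) (q - 1 - i))]"
  by pat_completeness auto
termination
  by (relation "measure (\<lambda>(xs, q). length xs + q)") auto

declare words.simps(3) [simp del]

lemma set_words: "set (words xs q) = {m. valid m \<and> args m = xs \<and> op_mult m = q}"
proof (induction xs q rule: words.induct)
  case 1
  have "m = []" if "valid m" "args m = []" for m using that args_eq_Nil_iff by blast
  then show ?case by auto
next
  case (2 q)
  have "m = []" if "valid m" "args m = []" for m using that args_eq_Nil_iff by blast
  then show ?case by fastforce
next
  case (3 x xs q)
  have Arg: "set (words xs q) = {m. valid m \<and> args m = xs \<and> op_mult m = q}"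
    by (rule 3)
  have Op: "set (words (take k (x # xs)) i) = {m. valid m \<and> args m = take k (x # xs) \<and> op_mult m = i}"
    "set (words (drop k (x # xs)) (q - 1 - i)) =
       {m. valid m \<and> args m = drop k (x # xs) \<and> op_mult m = q - 1 - i}"
    if "0 < k" "k \<le> length (x # xs)" "i < q" for k i
  proof -
    have "k \<in> set [1..<Suc (length (x # xs))]" "i \<in> set [0..<q]"
      using that by (simp_all del: upt_Suc)
    then show "set (words (take k (x # xs)) i) = {m. valid m \<and> args m = take k (x # xs) \<and> op_mult m = i}"
      "set (words (drop k (x # xs)) (q - 1 - i)) =
       {m. valid m \<and> args m = drop k (x # xs) \<and> op_mult m = q - 1 - i}"
      using 3(2,3)[of k i] by blast+
  qed
  have step: "m \<in> set (words (x # xs) q) \<longleftrightarrow>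
      (\<exists>w. m = Arg x # w \<and> w \<in> set (words xs q)) \<or>
      (\<exists>k i u w. 0 < k \<and> k \<le> length (x # xs) \<and> i < q \<and> m = Op u # w \<and>
        u \<in> set (words (take k (x # xs)) i) \<and> w \<in> set (words (drop k (x # xs)) (q - 1 - i)))" for m
  proof -
    have "set (words (x # xs) q) = (#) (Arg x) ` set (words xs q) \<union>
        (\<Union>k\<in>{1..<Suc (length (x # xs))}. \<Union>i\<in>{0..<q}. (\<lambda>(u, w). Op u # w) `
          (set (words (take k (x # xs)) i) \<times> set (words (drop k (x # xs)) (q - 1 - i))))"
      unfolding words.simps(3) set_append set_map set_concat set_product set_upt image_image ..
    then show ?thesis
      by (simp only: Un_iff UN_iff image_iff Bex_def atLeastLessThan_iff mem_Sigma_iff split_paired_Ex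
          prod.case less_Suc_eq_le One_nat_def Suc_le_eq) blast
  qed
  show ?case
  proof (intro Set.set_eqI iffI)
    fix m assume "m \<in> set (words (x # xs) q)"
    then consider w where "m = Arg x # w" "w \<in> set (words xs q)"
      | k i u w where "m = Op u # w" "0 < k" "k \<le> length (x # xs)" "i < q"
          "u \<in> set (words (take k (x # xs)) i)" "w \<in> set (words (drop k (x # xs)) (q - 1 - i))"
      unfolding step by blast
    then show "m \<in> {m. valid m \<and> args m = x # xs \<and> op_mult m = q}"
    proof cases
      case 1
      then show ?thesis unfolding Arg by simp
    next
      case (2 k i u w)
      then have u: "valid u" "args u = take k (x # xs)" "op_mult u = i"
        and w: "valid w" "args w = drop k (x # xs)" "op_mult w = q - 1 - i"
        unfolding Op[OF 2(2,3,4)] by simp_all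
      have "u \<noteq> []" using u(2) 2(2) by auto
      moreover have "args m = x # xs" using 2(1) u(2) w(2) by simp
      ultimately show ?thesis using 2(1,4) u(1,3) w(1,3) by simp
    qed
  next
    fix m assume "m \<in> {m. valid m \<and> args m = x # xs \<and> op_mult m = q}"
    then have m: "valid m" "args m = x # xs" "op_mult m = q" by auto
    show "m \<in> set (words (x # xs) q)"
    proof (cases m rule: args.cases)
      case (2 i w)
      then show ?thesis unfolding step Arg using m by simp
    next
      case (3 u w)
      have k: "0 < length (args u)" using m 3 args_eq_Nil_iff[of u] by auto
      have split: "x # xs = args u @ args w" using m 3 by simp
      have kl: "length (args u) \<le> length (x # xs)" unfolding split by simp
      have i: "op_mult u < q" using m 3 by simp
      have "take (length (args u)) (x # xs) = args u" "drop (length (args u)) (x # xs) = args w"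
        unfolding split by simp_all
      then have "u \<in> set (words (take (length (args u)) (x # xs)) (op_mult u))"
        "w \<in> set (words (drop (length (args u)) (x # xs)) (q - 1 - op_mult u))"
        unfolding Op[OF k kl i] using m 3 by auto
      then show ?thesis unfolding step using k kl i 3 by blast
    qed (use m in simp)
  qed
qed

lemma Mon_eq_words:
  assumes "0 < p"
  shows "Mon p q = set (words [1..<Suc p] q)"
proof -
  have "[1..<Suc p] \<noteq> []" using assms by simp
  then have "args m = [1..<Suc p] \<Longrightarrow> m \<noteq> []" for m by force
  then show ?thesis unfolding Mon_def op_monomials_iff set_words by blast
qed

abbreviation (input) X :: omon where "X \<equiv> [Arg 1]"
abbreviation (input) Y :: omon where "Y \<equiv> [Arg 2]"
abbreviation (input) Z :: omon where "Z \<equiv> [Arg 3]"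

text \<open>
  The order is that of evaluation: applying a rule \<open>L(uv) = \<beta> L(u)v + \<gamma> uL(v)\<close>, every word after the
  first six, in which \<open>L\<close> stands on single arguments only, becomes a combination of words that come
  before it.
\<close>

definition monomials :: "omon list" where
  "monomials =
    [L (L X) @ Y @ Z, X @ L (L Y) @ Z, X @ Y @ L (L Z),
     L X @ L Y @ Z, L X @ Y @ L Z, X @ L Y @ L Z,
     L (L X @ Y) @ Z, L (X @ L Y) @ Z, L (X @ Y) @ L Z,
     L X @ L (Y @ Z), X @ L (L Y @ Z), X @ L (Y @ L Z),
     L (L (X @ Y)) @ Z, X @ L (L (Y @ Z)),
     L (L X @ Y @ Z), L (X @ L Y @ Z), L (X @ Y @ L Z),
     L (L (X @ Y) @ Z), L (X @ L (Y @ Z)), L (L (X @ Y @ Z))]"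

lemma distinct_monomials: "distinct monomials"
  by (simp add: monomials_def)

lemma set_monomials: "set monomials = Mon 3 2"
proof -
  have "[1..<Suc 3] = [1, 2, 3]" by (simp add: upt_rec)
  then have "Mon 3 2 = set (words [1, 2, 3] 2)"
    using Mon_eq_words[of 3 2] by (simp only: zero_less_numeral)
  also have "\<dots> = set monomials"
    by code_simp
  finally show ?thesis ..
qed

section \<open>Functionals that annihilate the consequences\<close>

text \<open>
  The pairing turns a function on monomials into a linear functional. The null space of the matrix
  of consequences consists of the functionals that vanish on every consequence, and \<open>pairing_lin\<close>
  evaluates such a functional on a composition without computing the coefficients of the result.
\<close>

definition pairing :: "'a::field_char_0 opoly \<Rightarrow> (omon \<Rightarrow> 'a) \<Rightarrow> 'a" where
  "pairing S f = (\<Sum>m\<in>Poly_Mapping.keys S. Poly_Mapping.lookup S m * f m)"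

lemma pairing_eq_sum:
  assumes "finite A" "\<And>m. m \<in> Poly_Mapping.keys S \<Longrightarrow> m \<notin> A \<Longrightarrow> f m = 0"
  shows "pairing S f = (\<Sum>m\<in>A. Poly_Mapping.lookup S m * f m)"
proof -
  have "pairing S f = (\<Sum>m\<in>Poly_Mapping.keys S \<inter> A. Poly_Mapping.lookup S m * f m)"
    unfolding pairing_def by (rule sum.mono_neutral_right) (use assms in auto)
  also have "\<dots> = (\<Sum>m\<in>A. Poly_Mapping.lookup S m * f m)"
    by (rule sum.mono_neutral_left) (use assms in \<open>auto simp: in_keys_iff\<close>)
  finally show ?thesis .
qed

lemma pairing_add: "pairing (S + T) f = pairing S f + pairing T f"
proof -
  let ?A = "Poly_Mapping.keys S \<union> Poly_Mapping.keys T"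
  have "Poly_Mapping.keys (S + T) \<subseteq> ?A" by (rule Poly_Mapping.keys_add)
  then have "pairing (S + T) f = (\<Sum>m\<in>?A. Poly_Mapping.lookup (S + T) m * f m)"
    by (intro pairing_eq_sum) auto
  also have "\<dots> = pairing S f + pairing T f"
    using pairing_eq_sum[of ?A S f] pairing_eq_sum[of ?A T f]
    by (auto simp: lookup_add distrib_right sum.distrib simp del: in_keys_iff)
  finally show ?thesis .
qed

lemma pairing_zero [simp]: "pairing 0 f = 0"
  by (simp add: pairing_def)

lemma pairing_single [simp]: "pairing (Poly_Mapping.single m t) f = t * f m"
  by (subst pairing_eq_sum[of "{m}"]) (auto split: if_splits)

lemma pairing_sum: "pairing (\<Sum>i\<in>A. S i) f = (\<Sum>i\<in>A. pairing (S i) f)"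
  by (induction A rule: infinite_finite_induct) (simp_all add: pairing_add)

lemma pairing_lin: "pairing (lin g S) f = pairing S (\<lambda>m. f (g m))"
  unfolding lin_def pairing_sum pairing_single by (simp add: pairing_def)

lemma lookup_scale: "Poly_Mapping.lookup (scale t S) m = t * Poly_Mapping.lookup S m"
  by (simp add: scale_def Poly_Mapping.map.rep_eq when_def)

lemma scale_single: "scale t (omon_vec m) = Poly_Mapping.single m t"
  by (rule poly_mapping_eqI) (simp add: lookup_scale lookup_single when_def)

definition identity :: "'a::field_char_0 \<Rightarrow> 'a \<Rightarrow> 'a \<Rightarrow> 'a opoly" where
  "identity a b c = scale a (omon_vec L_xy) + scale b (omon_vec Lx_y) + scale c (omon_vec x_Ly)"

lemma lookup_identity:
  "Poly_Mapping.lookup (identity a b c) L_xy = a"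
  "Poly_Mapping.lookup (identity a b c) Lx_y = b"
  "Poly_Mapping.lookup (identity a b c) x_Ly = c"
  by (simp_all add: identity_def scale_single lookup_add lookup_single)

lemma identity_eq_iff: "identity a b c = identity a' b' c' \<longleftrightarrow> a = a' \<and> b = b' \<and> c = c'"
  by (metis lookup_identity)

lemma scale_identity: "scale t (identity a b c) = identity (t * a) (t * b) (t * c)"
  by (rule poly_mapping_eqI) (simp add: identity_def lookup_scale lookup_add algebra_simps)

lemma pairing_identity: "pairing (identity a b c) f = a * f L_xy + b * f Lx_y + c * f x_Ly"
  by (simp add: identity_def scale_single pairing_add)

definition annihilates :: "(omon \<Rightarrow> 'a) \<Rightarrow> 'a::field_char_0 opoly \<Rightarrow> bool" where
  "annihilates f R \<longleftrightarrow> (\<forall>S\<in>set (consequences R). pairing S f = 0)"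

text \<open>
  The ordering of the basis disappears here: null vectors of the matrix are the annihilating
  functionals supported in the basis, and the free coordinates become a list \<open>ns\<close> of monomials.
\<close>

lemma rank_consequence_matrix:
  fixes R :: "'a::field_char_0 opoly"
  assumes bs: "distinct bs"
    and I: "distinct ns" "set ns \<subseteq> set bs"
    and unique: "\<And>f. annihilates f R \<Longrightarrow> (\<And>m. m \<notin> set bs \<Longrightarrow> f m = 0) \<Longrightarrow>
      (\<And>m. m \<in> set ns \<Longrightarrow> f m = 0) \<Longrightarrow> \<forall>m\<in>set bs. f m = 0"
    and extend: "\<And>g. \<exists>f. annihilates f R \<and> (\<forall>m. m \<notin> set bs \<longrightarrow> f m = 0) \<and> (\<forall>m\<in>set ns. f m = g m)"
  shows "mat_rank (consequence_matrix bs R) = length bs - length ns"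
proof -
  let ?A = "consequence_matrix bs R"
  let ?nr = "length (consequences R)"
  have A: "?A \<in> carrier_mat ?nr (length bs)"
    by (simp add: consequence_matrix_def mat_of_rows_list_def)
  have row: "(\<Sum>j<length bs. ?A $$ (r, j) * f (bs ! j)) = pairing (consequences R ! r) f"
    if "r < ?nr" "\<And>m. m \<notin> set bs \<Longrightarrow> f m = 0" for f r
  proof -
    have "pairing (consequences R ! r) f =
        (\<Sum>m\<in>set bs. Poly_Mapping.lookup (consequences R ! r) m * f m)"
      using that by (intro pairing_eq_sum) auto
    also have "\<dots> = (\<Sum>j<length bs. Poly_Mapping.lookup (consequences R ! r) (bs ! j) * f (bs ! j))"
      by (rule sum.reindex_bij_betw[symmetric]) (rule bij_betw_nth[OF bs], auto)
    also have "\<dots> = (\<Sum>j<length bs. ?A $$ (r, j) * f (bs ! j))"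
      using that by (intro sum.cong) (simp_all add: consequence_matrix_def mat_of_rows_list_def)
    finally show ?thesis ..
  qed
  have annihilates_iff_row: "annihilates f R \<longleftrightarrow> (\<forall>r<?nr. (\<Sum>j<length bs. ?A $$ (r, j) * f (bs ! j)) = 0)"
    if "\<And>m. m \<notin> set bs \<Longrightarrow> f m = 0" for f
    unfolding annihilates_def all_set_conv_all_nth using row[of _ f] that by simp
  define I where "I = {j. j < length bs \<and> bs ! j \<in> set ns}"
  have "(!) bs ` I = set ns"
    using I(2) by (auto simp: I_def in_set_conv_nth image_iff subset_iff) metis
  moreover have "inj_on ((!) bs) I"
    using bs by (auto simp: inj_on_def I_def nth_eq_iff_index_eq)
  ultimately have "card I = card (set ns)"
    by (metis card_image)
  then have card_I: "card I = length ns"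
    using I(1) by (simp add: distinct_card)
  have "vec_space.rank ?nr ?A = length bs - card I"
  proof (rule rank_eq_codim_of_relations[OF A])
    show "I \<subseteq> {..<length bs}" by (auto simp: I_def)
  next
    fix c :: "nat \<Rightarrow> 'a" and j
    assume c: "\<And>r. r < ?nr \<Longrightarrow> (\<Sum>j<length bs. ?A $$ (r, j) * c j) = 0"
      "\<And>i. i \<in> I \<Longrightarrow> c i = 0" and j: "j < length bs"
    define f where "f m = (if m \<in> set bs then c (the_inv_into {..<length bs} ((!) bs) m) else 0)" for m
    have f: "f (bs ! i) = c i" if "i < length bs" for i
      using that bs by (simp add: f_def the_inv_into_f_f inj_on_nth)
    have f0: "f m = 0" if "m \<notin> set bs" for m
      using that by (simp add: f_def)
    have "annihilates f R"
      using annihilates_iff_row[of f] f0 c(1) by (simp add: f)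
    moreover have "f m = 0" if m: "m \<in> set ns" for m
    proof -
      obtain i where "i < length bs" "m = bs ! i" using m I(2) by (metis in_set_conv_nth subset_iff)
      then show ?thesis using f m c(2) by (simp add: I_def)
    qed
    ultimately have "\<forall>m\<in>set bs. f m = 0"
      using unique[of f] f0 by blast
    then show "c j = 0" using f j by auto
  next
    fix g :: "nat \<Rightarrow> 'a"
    obtain f where f: "annihilates f R" "\<forall>m. m \<notin> set bs \<longrightarrow> f m = 0"
      "\<forall>m\<in>set ns. f m = g (the_inv_into {..<length bs} ((!) bs) m)"
      using extend[of "\<lambda>m. g (the_inv_into {..<length bs} ((!) bs) m)"] by blast
    have "\<forall>i\<in>I. f (bs ! i) = g i"
      using f(3) bs by (simp add: I_def the_inv_into_f_f inj_on_nth)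
    moreover have "\<forall>r<?nr. (\<Sum>j<length bs. ?A $$ (r, j) * f (bs ! j)) = 0"
      using annihilates_iff_row[of f] f(1,2) by blast
    ultimately show "\<exists>c. (\<forall>r<?nr. (\<Sum>j<length bs. ?A $$ (r, j) * c j) = 0) \<and> (\<forall>i\<in>I. c i = g i)"
      by (intro exI[of _ "\<lambda>i. f (bs ! i)"]) simp
  qed
  then show ?thesis
    using A card_I by (simp add: mat_rank_def)
qed

text \<open>
  Each conjunct is the identity with arguments substituted, multiplied by an argument, or put under
  \<open>L\<close>: the first six are \<open>R(u, v)\<close> with \<open>L\<close> on one argument and a product in one place, the next six
  are \<open>R(x, y)z\<close> and \<open>xR(y, z)\<close> with \<open>L\<close> on one argument, then \<open>L\<close> applied to \<open>R(xy, z)\<close>,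
  \<open>R(x, yz)\<close>, \<open>R(x, y)z\<close> and \<open>xR(y, z)\<close>, and finally \<open>R(L(xy), z)\<close>, \<open>R(x, L(yz))\<close>,
  \<open>L(R(x, y))z\<close> and \<open>xL(R(y, z))\<close>. The other eight consequences repeat some of these.
\<close>

lemma annihilates_identity_iff:
  "annihilates f (identity a b c) \<longleftrightarrow>
    (let rel = (\<lambda>u v w. a * f u + b * f v + c * f w = 0) in
      rel (L (L X @ Y @ Z)) (L (L X @ Y) @ Z) (L X @ Y @ L Z) \<and>
      rel (L (X @ L Y @ Z)) (L (X @ L Y) @ Z) (X @ L Y @ L Z) \<and>
      rel (L (X @ Y @ L Z)) (L (X @ Y) @ L Z) (X @ Y @ L (L Z)) \<and>
      rel (L (L X @ Y @ Z)) (L (L X) @ Y @ Z) (L X @ L (Y @ Z)) \<and>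
      rel (L (X @ L Y @ Z)) (L X @ L Y @ Z) (X @ L (L Y @ Z)) \<and>
      rel (L (X @ Y @ L Z)) (L X @ Y @ L Z) (X @ L (Y @ L Z)) \<and>
      rel (L (L X @ Y) @ Z) (L (L X) @ Y @ Z) (L X @ L Y @ Z) \<and>
      rel (L (X @ L Y) @ Z) (L X @ L Y @ Z) (X @ L (L Y) @ Z) \<and>
      rel (L (X @ Y) @ L Z) (L X @ Y @ L Z) (X @ L Y @ L Z) \<and>
      rel (L X @ L (Y @ Z)) (L X @ L Y @ Z) (L X @ Y @ L Z) \<and>
      rel (X @ L (L Y @ Z)) (X @ L (L Y) @ Z) (X @ L Y @ L Z) \<and>
      rel (X @ L (Y @ L Z)) (X @ L Y @ L Z) (X @ Y @ L (L Z)) \<and>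
      rel (L (L (X @ Y @ Z))) (L (L (X @ Y) @ Z)) (L (X @ Y @ L Z)) \<and>
      rel (L (L (X @ Y @ Z))) (L (L X @ Y @ Z)) (L (X @ L (Y @ Z))) \<and>
      rel (L (L (X @ Y) @ Z)) (L (L X @ Y @ Z)) (L (X @ L Y @ Z)) \<and>
      rel (L (X @ L (Y @ Z))) (L (X @ L Y @ Z)) (L (X @ Y @ L Z)) \<and>
      rel (L (L (X @ Y) @ Z)) (L (L (X @ Y)) @ Z) (L (X @ Y) @ L Z) \<and>
      rel (L (X @ L (Y @ Z))) (L X @ L (Y @ Z)) (X @ L (L (Y @ Z))) \<and>
      rel (L (L (X @ Y)) @ Z) (L (L X @ Y) @ Z) (L (X @ L Y) @ Z) \<and>
      rel (X @ L (L (Y @ Z))) (X @ L (L Y @ Z)) (X @ L (Y @ L Z)))"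
  unfolding annihilates_def consequences_def Let_def
  by (simp add: pairing_lin pairing_identity comp_L_def comp_B_def B_comp_def op_degree_def
      numeral_2_eq_2 numeral_3_eq_3 conj_ac)

section \<open>Identities that evaluate the operator on products\<close>

lemma ex_function_with_values:
  assumes "distinct ms" "length ts = length ms"
  shows "\<exists>f. (\<forall>m. m \<notin> set ms \<longrightarrow> f m = 0) \<and> map f ms = ts"
  using assms
proof (induction ms arbitrary: ts)
  case (Cons m ms)
  then obtain t ts' where ts: "ts = t # ts'" by (cases ts) auto
  then obtain f where f: "\<forall>m. m \<notin> set ms \<longrightarrow> f m = 0" "map f ms = ts'"
    using Cons by auto
  have "map (f(m := t)) ms = map f ms" using Cons.prems(1) by (intro map_cong) auto
  then show ?case using f ts by (intro exI[of _ "f(m := t)"]) auto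
qed auto

text \<open>
  The form in which the rank is computed in each case: an annihilating functional is exhibited by
  the list of its values on \<open>monomials\<close>.
\<close>

lemma rank_identity:
  fixes a b c :: "'a::field_char_0"
  assumes bs: "distinct bs" "set bs = Mon 3 2"
    and ns: "distinct ns" "set ns \<subseteq> set monomials" "length ns = k"
    and unique: "\<And>f. annihilates f (identity a b c) \<Longrightarrow> (\<And>m. m \<in> set ns \<Longrightarrow> f m = 0) \<Longrightarrow> \<forall>m\<in>set monomials. f m = 0"
    and extend: "\<And>g. \<exists>ts. length ts = 20 \<and> (\<forall>f. map f monomials = ts \<longrightarrow>
      annihilates f (identity a b c) \<and> (\<forall>m\<in>set ns. f m = g m))"
  shows "mat_rank (consequence_matrix bs (identity a b c)) = 20 - k"
proof -
  have len: "length monomials = 20" by (simp add: monomials_def)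
  have set_bs: "set bs = set monomials" using bs(2) by (simp add: set_monomials)
  then have "length bs = 20"
    using bs(1) distinct_monomials len by (metis distinct_card)
  moreover have "mat_rank (consequence_matrix bs (identity a b c)) = length bs - length ns"
  proof (rule rank_consequence_matrix[OF bs(1) ns(1)])
    show "\<exists>f. annihilates f (identity a b c) \<and> (\<forall>m. m \<notin> set bs \<longrightarrow> f m = 0) \<and> (\<forall>m\<in>set ns. f m = g m)"
      for g
    proof -
      obtain ts where ts: "length ts = 20" "\<And>f. map f monomials = ts \<Longrightarrow>
          annihilates f (identity a b c) \<and> (\<forall>m\<in>set ns. f m = g m)"
        using extend[of g] by blast
      obtain f where "\<forall>m. m \<notin> set monomials \<longrightarrow> f m = 0" "map f monomials = ts"
        using ex_function_with_values[OF distinct_monomials, of ts] ts(1) len by auto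
      then show ?thesis using ts(2) set_bs by blast
    qed
  qed (use ns unique set_bs in auto)
  ultimately show ?thesis using ns(3) by simp
qed

text \<open>
  The values that the rule \<open>L(uv) = \<beta> L(u)v + \<gamma> uL(v)\<close> forces on a functional, in the order of
  \<open>monomials\<close>, from its values on the six words with \<open>L\<close> on single arguments. The parameter \<open>xz\<close>, for
  instance, is the value at \<open>L(x)yL(z)\<close>, and \<open>xx\<close> the value at \<open>L(L(x))yz\<close>. The local name \<open>LLx_y\<close>
  stands for the value at \<open>L(L(x)y)z\<close>, \<open>x_yz\<close> for that at \<open>L(x)L(yz)\<close>, and so on; \<open>Lx\<close>, \<open>Ly\<close>, \<open>Lz\<close>
  stand for the values at \<open>L(L(x)yz)\<close>, \<open>L(xL(y)z)\<close>, \<open>L(xyL(z))\<close>.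
\<close>

definition derivation_values :: "'a::comm_ring_1 \<Rightarrow> 'a \<Rightarrow> 'a \<Rightarrow> 'a \<Rightarrow> 'a \<Rightarrow> 'a \<Rightarrow> 'a \<Rightarrow> 'a \<Rightarrow> 'a list" where
  "derivation_values \<beta> \<gamma> xx yy zz xy xz yz =
    (let LLx_y = \<beta> * xx + \<gamma> * xy; Lx_Ly = \<beta> * xy + \<gamma> * yy; xy_z = \<beta> * xz + \<gamma> * yz;
         x_yz = \<beta> * xy + \<gamma> * xz; Ly_z = \<beta> * yy + \<gamma> * yz; y_Lz = \<beta> * yz + \<gamma> * zz;
         Lx = \<beta> * LLx_y + \<gamma> * xz; Ly = \<beta> * Lx_Ly + \<gamma> * yz; Lz = \<beta> * xy_z + \<gamma> * zz
     in [xx, yy, zz, xy, xz, yz,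
         LLx_y, Lx_Ly, xy_z, x_yz, Ly_z, y_Lz,
         \<beta> * LLx_y + \<gamma> * Lx_Ly, \<beta> * Ly_z + \<gamma> * y_Lz,
         Lx, Ly, Lz,
         \<beta> * Lx + \<gamma> * Ly, \<beta> * Ly + \<gamma> * Lz, \<beta> * (\<beta> * Lx + \<gamma> * Ly) + \<gamma> * Lz])"

text \<open>
  The two sides evaluate \<open>L(uvw)\<close> as \<open>L((uv)w)\<close> and as \<open>L(u(vw))\<close>, where the variables stand for
  \<open>L(u)vw\<close>, \<open>uL(v)w\<close> and \<open>uvL(w)\<close>. Their difference is the only obstruction to consistency.
\<close>

lemma twisted_associativity_iff:
  fixes \<beta> \<gamma> u v w :: "'a::comm_ring_1"
  shows "\<beta> * (\<beta> * u + \<gamma> * v) + \<gamma> * w = \<beta> * u + \<gamma> * (\<beta> * v + \<gamma> * w) \<longleftrightarrow>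
    (\<beta>\<^sup>2 - \<beta>) * u = (\<gamma>\<^sup>2 - \<gamma>) * w"
proof -
  have "\<beta> * (\<beta> * u + \<gamma> * v) + \<gamma> * w - (\<beta> * u + \<gamma> * (\<beta> * v + \<gamma> * w)) =
      (\<beta>\<^sup>2 - \<beta>) * u - (\<gamma>\<^sup>2 - \<gamma>) * w"
    by (simp add: power2_eq_square algebra_simps)
  then show ?thesis by (metis eq_iff_diff_eq_0)
qed

text \<open>
  Two operators on the same product can be evaluated in either order; this disposes of the
  consequences \<open>R(L(xy), z)\<close> and \<open>R(x, L(yz))\<close>.
\<close>

lemma combination_exchange:
  fixes \<beta> \<gamma> :: "'a::comm_ring_1"
  shows "\<beta> * (\<beta> * r + \<gamma> * s) + \<gamma> * (\<beta> * t + \<gamma> * u) = \<beta> * (\<beta> * r + \<gamma> * t) + \<gamma> * (\<beta> * s + \<gamma> * u)"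
  by (simp add: algebra_simps)

text \<open>
  Evaluating the second operator preserves a relation \<open>p L(u)vw = q uvL(w)\<close>; hence \<open>L\<close> applied to it
  yields no new constraint.
\<close>

lemma scaled_combination:
  fixes p q \<beta> \<gamma> :: "'a::comm_ring_1"
  assumes "p * x = q * x'" "p * y = q * y'" "p * z = q * z'"
  shows "p * (\<beta> * (\<beta> * x + \<gamma> * y) + \<gamma> * z) = q * (\<beta> * (\<beta> * x' + \<gamma> * y') + \<gamma> * z')"
proof -
  have "p * (\<beta> * (\<beta> * x + \<gamma> * y) + \<gamma> * z) = \<beta> * (\<beta> * (p * x) + \<gamma> * (p * y)) + \<gamma> * (p * z)"
    by (simp add: algebra_simps)
  also have "\<dots> = q * (\<beta> * (\<beta> * x' + \<gamma> * y') + \<gamma> * z')"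
    unfolding assms by (simp add: algebra_simps)
  finally show ?thesis .
qed

text \<open>
  Fourteen consequences determine the functional from its values on the six words with \<open>L\<close> on single
  arguments. The other six evaluate a word a second time. The two bracketings of \<open>xyz\<close> with \<open>L\<close> on one
  of the three arguments give the three displayed constraints. The two bracketings under \<open>L(L(xyz))\<close>
  give a combination of these, and \<open>R(L(xy), z)\<close> and \<open>R(x, L(yz))\<close> follow by exchanging the order in
  which the two operators are evaluated.
\<close>

lemma annihilates_derivation_iff:
  fixes a \<beta> \<gamma> :: "'a::field_char_0"
  assumes "a \<noteq> 0"
  shows "annihilates f (identity a (- (a * \<beta>)) (- (a * \<gamma>))) \<longleftrightarrow>
    map f monomials = derivation_values \<beta> \<gamma>
      (f (L (L X) @ Y @ Z)) (f (X @ L (L Y) @ Z)) (f (X @ Y @ L (L Z)))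
      (f (L X @ L Y @ Z)) (f (L X @ Y @ L Z)) (f (X @ L Y @ L Z)) \<and>
    (\<beta>\<^sup>2 - \<beta>) * f (L (L X) @ Y @ Z) = (\<gamma>\<^sup>2 - \<gamma>) * f (L X @ Y @ L Z) \<and>
    (\<beta>\<^sup>2 - \<beta>) * f (L X @ L Y @ Z) = (\<gamma>\<^sup>2 - \<gamma>) * f (X @ L Y @ L Z) \<and>
    (\<beta>\<^sup>2 - \<beta>) * f (L X @ Y @ L Z) = (\<gamma>\<^sup>2 - \<gamma>) * f (X @ Y @ L (L Z))"
    (is "?lhs \<longleftrightarrow> ?values \<and> ?x \<and> ?y \<and> ?z")
proof -
  have rel: "a * u + - (a * \<beta>) * v + - (a * \<gamma>) * w = 0 \<longleftrightarrow> u = \<beta> * v + \<gamma> * w" for u v w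
  proof -
    have "a * u + - (a * \<beta>) * v + - (a * \<gamma>) * w = a * (u - (\<beta> * v + \<gamma> * w))"
      by (simp add: algebra_simps)
    then show ?thesis using assms by simp
  qed
  show ?thesis
  proof
    assume ?lhs
    note e = this[unfolded annihilates_identity_iff Let_def rel]
    have ?values
      using e unfolding monomials_def derivation_values_def Let_def list.map list.inject by metis
    moreover have ?x
      unfolding twisted_associativity_iff[of \<beta> _ \<gamma> "f (L X @ L Y @ Z)", symmetric] using e by metis
    moreover have ?y
      unfolding twisted_associativity_iff[of \<beta> _ \<gamma> "f (X @ L (L Y) @ Z)", symmetric] using e by metis
    moreover have ?z
      unfolding twisted_associativity_iff[of \<beta> _ \<gamma> "f (X @ L Y @ L Z)", symmetric] using e by metis
    ultimately show "?values \<and> ?x \<and> ?y \<and> ?z" by blast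
  next
    assume r: "?values \<and> ?x \<and> ?y \<and> ?z"
    then have e: ?values and x: ?x and y: ?y and z: ?z by blast+
    note e = e[unfolded monomials_def derivation_values_def Let_def list.map list.inject]
    let ?Lx = "f (L (L X @ Y @ Z))" and ?Ly = "f (L (X @ L Y @ Z))" and ?Lz = "f (L (X @ Y @ L Z))"
    have Lx: "?Lx = \<beta> * f (L (L X) @ Y @ Z) + \<gamma> * f (L X @ L (Y @ Z))"
      using e x twisted_associativity_iff[of \<beta> _ \<gamma> "f (L X @ L Y @ Z)"] by metis
    have Ly: "?Ly = \<beta> * f (L X @ L Y @ Z) + \<gamma> * f (X @ L (L Y @ Z))"
      using e y twisted_associativity_iff[of \<beta> _ \<gamma> "f (X @ L (L Y) @ Z)"] by metis
    have Lz: "?Lz = \<beta> * f (L X @ Y @ L Z) + \<gamma> * f (X @ L (Y @ L Z))"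
      using e z twisted_associativity_iff[of \<beta> _ \<gamma> "f (X @ L Y @ L Z)"] by metis
    have "?Lx = \<beta> * (\<beta> * f (L (L X) @ Y @ Z) + \<gamma> * f (L X @ L Y @ Z)) + \<gamma> * f (L X @ Y @ L Z)"
      "?Lz = \<beta> * (\<beta> * f (L X @ Y @ L Z) + \<gamma> * f (X @ L Y @ L Z)) + \<gamma> * f (X @ Y @ L (L Z))"
      using e by metis+
    then have "(\<beta>\<^sup>2 - \<beta>) * ?Lx = (\<gamma>\<^sup>2 - \<gamma>) * ?Lz"
      using scaled_combination[OF x y z] by presburger
    then have LL: "f (L (L (X @ Y @ Z))) = \<beta> * ?Lx + \<gamma> * f (L (X @ L (Y @ Z)))"
      using e twisted_associativity_iff[of \<beta> ?Lx \<gamma> ?Ly ?Lz] by metis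
    have "f (L (L (X @ Y) @ Z)) = \<beta> * f (L (L (X @ Y)) @ Z) + \<gamma> * f (L (X @ Y) @ L Z)"
    proof -
      have "f (L (L (X @ Y) @ Z)) = \<beta> * ?Lx + \<gamma> * ?Ly"
        "?Lx = \<beta> * f (L (L X @ Y) @ Z) + \<gamma> * f (L X @ Y @ L Z)"
        "?Ly = \<beta> * f (L (X @ L Y) @ Z) + \<gamma> * f (X @ L Y @ L Z)"
        "f (L (L (X @ Y)) @ Z) = \<beta> * f (L (L X @ Y) @ Z) + \<gamma> * f (L (X @ L Y) @ Z)"
        "f (L (X @ Y) @ L Z) = \<beta> * f (L X @ Y @ L Z) + \<gamma> * f (X @ L Y @ L Z)"
        using e by metis+
      then show ?thesis using combination_exchange by metis
    qed
    moreover have "f (L (X @ L (Y @ Z))) = \<beta> * f (L X @ L (Y @ Z)) + \<gamma> * f (X @ L (L (Y @ Z)))"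
    proof -
      have "f (L (X @ L (Y @ Z))) = \<beta> * ?Ly + \<gamma> * ?Lz"
        "f (L X @ L (Y @ Z)) = \<beta> * f (L X @ L Y @ Z) + \<gamma> * f (L X @ Y @ L Z)"
        "f (X @ L (L (Y @ Z))) = \<beta> * f (X @ L (L Y @ Z)) + \<gamma> * f (X @ L (Y @ L Z))"
        using e by metis+
      then show ?thesis using Ly Lz using combination_exchange by metis
    qed
    ultimately show ?lhs
      unfolding annihilates_identity_iff Let_def rel
      using e Lx Ly Lz LL by (intro conjI) (assumption | metis)+
  qed
qed

text \<open>
  Put \<open>p = \<beta>\<^sup>2 - \<beta>\<close> and \<open>q = \<gamma>\<^sup>2 - \<gamma>\<close>. If both vanish, the six values are free and the rank is
  \<open>20 - 6\<close>. Otherwise the constraints \<open>p xx = q xz\<close>, \<open>p xy = q yz\<close>, \<open>p xz = q zz\<close> are independent: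
  if \<open>p \<noteq> 0\<close> they are solved for \<open>xx\<close>, \<open>xy\<close>, \<open>xz\<close>, and if \<open>p = 0\<close> they say that \<open>xz\<close>, \<open>yz\<close>, \<open>zz\<close>
  vanish.
\<close>

lemma rank_derivation:
  fixes a \<beta> \<gamma> :: "'a::field_char_0"
  assumes a: "a \<noteq> 0" and bs: "distinct bs" "set bs = Mon 3 2"
  shows "mat_rank (consequence_matrix bs (identity a (- (a * \<beta>)) (- (a * \<gamma>)))) =
    (if \<beta> \<in> {0, 1} \<and> \<gamma> \<in> {0, 1} then 14 else 17)"
proof -
  define p q where "p = \<beta>\<^sup>2 - \<beta>" and "q = \<gamma>\<^sup>2 - \<gamma>"
  have p: "p = 0 \<longleftrightarrow> \<beta> \<in> {0, 1}" and q: "q = 0 \<longleftrightarrow> \<gamma> \<in> {0, 1}"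
    by (auto simp: p_def q_def power2_eq_square)
  let ?R = "identity a (- (a * \<beta>)) (- (a * \<gamma>))"
  note iff = annihilates_derivation_iff[OF a, of _ \<beta> \<gamma>, folded p_def q_def]
  let ?xx = "L (L X) @ Y @ Z" and ?yy = "X @ L (L Y) @ Z" and ?zz = "X @ Y @ L (L Z)"
    and ?xy = "L X @ L Y @ Z" and ?xz = "L X @ Y @ L Z" and ?yz = "X @ L Y @ L Z"
  have zero: "\<forall>m\<in>set monomials. f m = 0"
    if "annihilates f ?R" "f ?xx = 0" "f ?yy = 0" "f ?zz = 0" "f ?xy = 0" "f ?xz = 0" "f ?yz = 0" for f
  proof -
    have "map f monomials = derivation_values \<beta> \<gamma> 0 0 0 0 0 0"
      using that(1) unfolding iff that(2-) by blast
    then have "set (map f monomials) = {0}" by (simp add: derivation_values_def)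
    then show ?thesis by auto
  qed
  have prescribed: "annihilates f ?R \<and> f ?xx = xx \<and> f ?yy = yy \<and> f ?zz = zz \<and> f ?xy = xy \<and> f ?xz = xz \<and> f ?yz = yz"
    if f: "map f monomials = derivation_values \<beta> \<gamma> xx yy zz xy xz yz"
      and rel: "p * xx = q * xz" "p * xy = q * yz" "p * xz = q * zz" for f xx yy zz xy xz yz
  proof -
    have t: "f ?xx = xx" "f ?yy = yy" "f ?zz = zz" "f ?xy = xy" "f ?xz = xz" "f ?yz = yz"
      using f unfolding monomials_def derivation_values_def Let_def list.map list.inject by blast+
    then show ?thesis unfolding iff t using f rel by blast
  qed
  have len: "length (derivation_values \<beta> \<gamma> xx yy zz xy xz yz) = 20" for xx yy zz xy xz yz
    by (simp add: derivation_values_def Let_def)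
  consider "p = 0" "q = 0" | "p \<noteq> 0" | "p = 0" "q \<noteq> 0" by blast
  then show ?thesis
  proof cases
    case 1
    have "mat_rank (consequence_matrix bs ?R) = 20 - 6"
    proof (rule rank_identity[OF bs, of "[?xx, ?yy, ?zz, ?xy, ?xz, ?yz]"])
      show "\<forall>m\<in>set monomials. f m = 0"
        if "annihilates f ?R" "\<And>m. m \<in> set [?xx, ?yy, ?zz, ?xy, ?xz, ?yz] \<Longrightarrow> f m = 0" for f
        using zero[OF that(1)] that(2) by simp
      show "\<exists>ts. length ts = 20 \<and> (\<forall>f. map f monomials = ts \<longrightarrow>
          annihilates f ?R \<and> (\<forall>m\<in>set [?xx, ?yy, ?zz, ?xy, ?xz, ?yz]. f m = g m))" for g
        using len prescribed[of _ "g ?xx" "g ?yy" "g ?zz" "g ?xy" "g ?xz" "g ?yz"] 1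
        by (intro exI[of _ "derivation_values \<beta> \<gamma> (g ?xx) (g ?yy) (g ?zz) (g ?xy) (g ?xz) (g ?yz)"]) simp
    qed (simp_all add: monomials_def)
    then show ?thesis using 1 p q by simp
  next
    case 2
    have "mat_rank (consequence_matrix bs ?R) = 20 - 3"
    proof (rule rank_identity[OF bs, of "[?yy, ?zz, ?yz]"])
      show "\<forall>m\<in>set monomials. f m = 0"
        if "annihilates f ?R" "\<And>m. m \<in> set [?yy, ?zz, ?yz] \<Longrightarrow> f m = 0" for f
      proof -
        have free: "f ?yy = 0" "f ?zz = 0" "f ?yz = 0" using that(2) by simp_all
        have rel: "p * f ?xx = q * f ?xz" "p * f ?xy = q * f ?yz" "p * f ?xz = q * f ?zz"
          using that(1) iff by blast+
        have xz: "f ?xz = 0" using rel(3) 2 unfolding free by simp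
        have xy: "f ?xy = 0" using rel(2) 2 unfolding free by simp
        have xx: "f ?xx = 0" using rel(1) 2 unfolding xz by simp
        show ?thesis by (rule zero[OF that(1) xx free(1,2) xy xz free(3)])
      qed
      show "\<exists>ts. length ts = 20 \<and> (\<forall>f. map f monomials = ts \<longrightarrow>
          annihilates f ?R \<and> (\<forall>m\<in>set [?yy, ?zz, ?yz]. f m = g m))" for g
        using len prescribed[of _ "q / p * (q / p * g ?zz)" "g ?yy" "g ?zz" "q / p * g ?yz" "q / p * g ?zz" "g ?yz"] 2
        by (intro exI[of _ "derivation_values \<beta> \<gamma> (q / p * (q / p * g ?zz)) (g ?yy) (g ?zz)
          (q / p * g ?yz) (q / p * g ?zz) (g ?yz)"]) simp
    qed (simp_all add: monomials_def)
    then show ?thesis using 2 p q by auto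
  next
    case 3
    have "mat_rank (consequence_matrix bs ?R) = 20 - 3"
    proof (rule rank_identity[OF bs, of "[?xx, ?yy, ?xy]"])
      show "\<forall>m\<in>set monomials. f m = 0"
        if "annihilates f ?R" "\<And>m. m \<in> set [?xx, ?yy, ?xy] \<Longrightarrow> f m = 0" for f
      proof -
        have free: "f ?xx = 0" "f ?yy = 0" "f ?xy = 0" using that(2) by simp_all
        have rel: "p * f ?xx = q * f ?xz" "p * f ?xy = q * f ?yz" "p * f ?xz = q * f ?zz"
          using that(1) iff by blast+
        have xz: "f ?xz = 0" using rel(1) 3 by simp
        have yz: "f ?yz = 0" using rel(2) 3 by simp
        have zz: "f ?zz = 0" using rel(3) 3 by simp
        show ?thesis by (rule zero[OF that(1) free(1,2) zz free(3) xz yz])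
      qed
      show "\<exists>ts. length ts = 20 \<and> (\<forall>f. map f monomials = ts \<longrightarrow>
          annihilates f ?R \<and> (\<forall>m\<in>set [?xx, ?yy, ?xy]. f m = g m))" for g
        using len prescribed[of _ "g ?xx" "g ?yy" 0 "g ?xy" 0 0] 3
        by (intro exI[of _ "derivation_values \<beta> \<gamma> (g ?xx) (g ?yy) 0 (g ?xy) 0 0"]) simp
    qed (simp_all add: monomials_def)
    then show ?thesis using 3 p q by auto
  qed
qed

section \<open>Identities without the operator on a product\<close>

text \<open>
  The identity \<open>L(x)y = 0\<close> kills exactly the words in which some \<open>L\<close> has a factor on its right;
  six words are left, and their values are free.
\<close>

lemma rank_left_annihilator:
  fixes b :: "'a::field_char_0"
  assumes b: "b \<noteq> 0" and bs: "distinct bs" "set bs = Mon 3 2"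
  shows "mat_rank (consequence_matrix bs (identity 0 b 0)) = 14"
proof -
  let ?ns = "[X @ Y @ L (L Z), X @ L (Y @ L Z), X @ L (L (Y @ Z)),
    L (X @ Y @ L Z), L (X @ L (Y @ Z)), L (L (X @ Y @ Z))]"
  have "mat_rank (consequence_matrix bs (identity 0 b 0)) = 20 - 6"
  proof (rule rank_identity[OF bs, of ?ns])
    show "\<forall>m\<in>set monomials. f m = 0"
      if "annihilates f (identity 0 b 0)" "\<And>m. m \<in> set ?ns \<Longrightarrow> f m = 0" for f
      using that b unfolding annihilates_identity_iff Let_def monomials_def by simp
    show "\<exists>ts. length ts = 20 \<and> (\<forall>f. map f monomials = ts \<longrightarrow>
        annihilates f (identity 0 b 0) \<and> (\<forall>m\<in>set ?ns. f m = g m))" for g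
      unfolding annihilates_identity_iff Let_def monomials_def
      by (intro exI[of _ "[0, 0, g (X @ Y @ L (L Z)), 0, 0, 0, 0, 0, 0, 0, 0, g (X @ L (Y @ L Z)),
        0, g (X @ L (L (Y @ Z))), 0, 0, g (L (X @ Y @ L Z)), 0, g (L (X @ L (Y @ Z))),
        g (L (L (X @ Y @ Z)))]"]) simp
  qed (simp_all add: monomials_def)
  then show ?thesis by simp
qed

text \<open>
  The mirror image: the words in which no \<open>L\<close> has a factor on its left survive.
\<close>

lemma rank_right_annihilator:
  fixes c :: "'a::field_char_0"
  assumes c: "c \<noteq> 0" and bs: "distinct bs" "set bs = Mon 3 2"
  shows "mat_rank (consequence_matrix bs (identity 0 0 c)) = 14"
proof -
  let ?ns = "[L (L X) @ Y @ Z, L (L X @ Y) @ Z, L (L (X @ Y)) @ Z,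
    L (L X @ Y @ Z), L (L (X @ Y) @ Z), L (L (X @ Y @ Z))]"
  have "mat_rank (consequence_matrix bs (identity 0 0 c)) = 20 - 6"
  proof (rule rank_identity[OF bs, of ?ns])
    show "\<forall>m\<in>set monomials. f m = 0"
      if "annihilates f (identity 0 0 c)" "\<And>m. m \<in> set ?ns \<Longrightarrow> f m = 0" for f
      using that c unfolding annihilates_identity_iff Let_def monomials_def by simp
    show "\<exists>ts. length ts = 20 \<and> (\<forall>f. map f monomials = ts \<longrightarrow>
        annihilates f (identity 0 0 c) \<and> (\<forall>m\<in>set ?ns. f m = g m))" for g
      unfolding annihilates_identity_iff Let_def monomials_def
      by (intro exI[of _ "[g (L (L X) @ Y @ Z), 0, 0, 0, 0, 0, g (L (L X @ Y) @ Z), 0, 0, 0, 0, 0,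
        g (L (L (X @ Y)) @ Z), 0, g (L (L X @ Y @ Z)), 0, 0, g (L (L (X @ Y) @ Z)), 0,
        g (L (L (X @ Y @ Z)))]"]) simp
  qed (simp_all add: monomials_def)
  then show ?thesis by simp
qed

text \<open>
  The identity \<open>L(x)y = \<delta> xL(y)\<close> takes the outer \<open>L\<close> of a factor to its right neighbour at the cost of a
  scalar \<open>\<delta>\<close>. The number of operators that enclose the whole product never changes, and according to
  this number every word reduces to a multiple of \<open>xyL(L(z))\<close>, \<open>L(xyL(z))\<close> or \<open>L(L(xyz))\<close>. An operator
  on \<open>yz\<close> is reached because \<open>\<delta> \<noteq> 0\<close>: comparing \<open>L(x)yz = \<delta> xL(yz)\<close> with \<open>L(x)yz = \<delta> xL(y)z\<close>
  gives \<open>xL(yz) = xL(y)z\<close>.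
\<close>

lemma rank_transfer:
  fixes b \<delta> :: "'a::field_char_0"
  assumes b: "b \<noteq> 0" and \<delta>: "\<delta> \<noteq> 0" and bs: "distinct bs" "set bs = Mon 3 2"
  shows "mat_rank (consequence_matrix bs (identity 0 b (- (b * \<delta>)))) = 17"
proof -
  let ?R = "identity 0 b (- (b * \<delta>))"
  have rel: "0 * u + b * v + - (b * \<delta>) * w = 0 \<longleftrightarrow> v = \<delta> * w" for u v w
    using b by (simp add: mult.assoc)
  let ?ns = "[X @ Y @ L (L Z), L (X @ Y @ L Z), L (L (X @ Y @ Z))]"
  have "mat_rank (consequence_matrix bs ?R) = 20 - 3"
  proof (rule rank_identity[OF bs, of ?ns])
    show "\<forall>m\<in>set monomials. f m = 0"
      if "annihilates f ?R" "\<And>m. m \<in> set ?ns \<Longrightarrow> f m = 0" for f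
      using that \<delta> unfolding annihilates_identity_iff Let_def rel monomials_def by auto
    show "\<exists>ts. length ts = 20 \<and> (\<forall>f. map f monomials = ts \<longrightarrow>
        annihilates f ?R \<and> (\<forall>m\<in>set ?ns. f m = g m))" for g
    proof -
      \<comment> \<open>The power of \<open>\<delta>\<close> counts the moves that carry the operators to the last factor, where an
        operator on \<open>yz\<close> counts like one on \<open>y\<close>.\<close>
      define t u where "t = g (L (X @ Y @ L Z))" and "u = g (X @ Y @ L (L Z))"
      show ?thesis
        unfolding annihilates_identity_iff Let_def rel monomials_def
        by (intro exI[of _ "[\<delta>^4 * u, \<delta>^2 * u, u, \<delta>^3 * u, \<delta>^2 * u, \<delta> * u,
          \<delta>^3 * u, \<delta>^2 * u, \<delta> * u, \<delta>^3 * u, \<delta>^2 * u, \<delta> * u, \<delta>^2 * u, \<delta>^2 * u,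
          \<delta>^2 * t, \<delta> * t, t, \<delta> * t, \<delta> * t, g (L (L (X @ Y @ Z)))]"])
          (simp add: power2_eq_square power3_eq_cube power4_eq_xxxx mult.assoc t_def u_def)
    qed
  qed (simp_all add: monomials_def)
  then show ?thesis by simp
qed

section \<open>Classification\<close>

lemma mem_rank14_identities_iff:
  fixes a b c :: "'a::field_char_0"
  shows "(\<exists>t S. t \<noteq> 0 \<and> S \<in> rank14_identities \<and> identity a b c = scale t S) \<longleftrightarrow>
    (a \<noteq> 0 \<and> b \<in> {0, - a} \<and> c \<in> {0, - a}) \<or> (a = 0 \<and> b \<noteq> 0 \<and> c = 0) \<or> (a = 0 \<and> b = 0 \<and> c \<noteq> 0)"
proof -
  have one: "scale 1 S = S" and zero: "scale 0 S = 0" for S :: "'a opoly"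
    by (rule poly_mapping_eqI; simp add: lookup_scale)+
  have neg: "scale (- 1) S = - S" for S :: "'a opoly"
    by (rule poly_mapping_eqI; simp add: lookup_scale)
  have eq: "rank14_identities = {identity 1 0 0, identity 1 0 (- 1), identity 1 (- 1) 0,
      identity 1 (- 1) (- 1), identity 0 1 0, identity 0 0 (1::'a)}"
    unfolding rank14_identities_def identity_def one zero neg by (simp add: diff_diff_eq)
  have "(\<exists>S\<in>rank14_identities. identity a b c = scale t S) \<longleftrightarrow>
      a = t \<and> b \<in> {0, - t} \<and> c \<in> {0, - t} \<or> a = 0 \<and> b = t \<and> c = 0 \<or> a = 0 \<and> b = 0 \<and> c = t" for t
    unfolding eq by (simp add: scale_identity identity_eq_iff) blast
  then have "(\<exists>t S. t \<noteq> 0 \<and> S \<in> rank14_identities \<and> identity a b c = scale t S) \<longleftrightarrow>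
      (\<exists>t. t \<noteq> 0 \<and> (a = t \<and> b \<in> {0, - t} \<and> c \<in> {0, - t} \<or> a = 0 \<and> b = t \<and> c = 0 \<or>
        a = 0 \<and> b = 0 \<and> c = t))"
    by blast
  then show ?thesis by blast
qed

theorem theorem5p1:
  fixes a b c :: "'a::field_char_0"
    and R :: "'a opoly"
    and bs :: "omon list"
  assumes R: "R = scale a (omon_vec L_xy) + scale b (omon_vec Lx_y) + scale c (omon_vec x_Ly)"
    and nonzero: "R \<noteq> 0"
    and basis_order: "distinct bs" "set bs = Mon 3 2"
  shows "mat_rank (consequence_matrix bs R) \<in> {14, 17} \<and>
    (mat_rank (consequence_matrix bs R) = 14 \<longleftrightarrow>
       (\<exists>t S. t \<noteq> 0 \<and> S \<in> rank14_identities \<and> R = scale t S))"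
proof -
  have R_eq: "R = identity a b c" by (simp add: R identity_def)
  have "identity 0 0 0 = (0::'a opoly)"
    by (rule poly_mapping_eqI) (simp add: identity_def lookup_add lookup_scale)
  then have "\<not> (a = 0 \<and> b = 0 \<and> c = 0)"
    using nonzero R_eq by auto
  then consider "a \<noteq> 0" | "a = 0" "b \<noteq> 0" "c = 0" | "a = 0" "b = 0" "c \<noteq> 0"
    | "a = 0" "b \<noteq> 0" "c \<noteq> 0" by blast
  then have "mat_rank (consequence_matrix bs R) =
    (if (a \<noteq> 0 \<and> b \<in> {0, - a} \<and> c \<in> {0, - a}) \<or> (a = 0 \<and> b \<noteq> 0 \<and> c = 0) \<or> (a = 0 \<and> b = 0 \<and> c \<noteq> 0)
     then 14 else 17)"
  proof cases
    case 1
    \<comment> \<open>Dividing by \<open>a\<close> gives the rule with \<open>\<beta> = - b / a\<close> and \<open>\<gamma> = - c / a\<close>.\<close>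
    have "- (a * (- b / a)) = b" "- (a * (- c / a)) = c" using 1 by simp_all
    moreover have "- b / a \<in> {0, 1} \<longleftrightarrow> b \<in> {0, - a}" for b using 1 by (auto simp: field_simps)
    ultimately show ?thesis
      using rank_derivation[OF 1 basis_order, of "- b / a" "- c / a"] 1 by (simp only: R_eq) simp
  next
    case 2
    then show ?thesis using rank_left_annihilator[OF 2(2) basis_order] by (simp add: R_eq)
  next
    case 3
    then show ?thesis using rank_right_annihilator[OF 3(3) basis_order] by (simp add: R_eq)
  next
    case 4
    have "- (b * (- c / b)) = c" "- c / b \<noteq> 0" using 4 by simp_all
    then show ?thesis
      using rank_transfer[OF 4(2) _ basis_order, of "- c / b"] 4 by (simp add: R_eq)
  qed
  then show ?thesis
    unfolding R_eq mem_rank14_identities_iff by auto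
qed

end
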